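(* Let $S$ be a finite set, let $S_1,\dots,S_n\subseteq S$, and let $k\ge 2$ be an integer. For a partition of $\{S_1,\dots,S_n\}$ into $k$ covers $c_1,\dots,c_k$, define its coverage as $\sum_{i=1}^k \left|\bigcup_{S_j\in c_i} S_j\right|$, and let $\mathrm{OPT}$ be the maximum coverage over all such partitions. Consider the (distributed) greedy algorithm: starting with all covers empty, for $j=1,2,\dots,n$ in order, assign $S_j$ to a cover $c_i$ that maximizes the number of elements of $S_j$ not contained in any subset already assigned to $c_i$ (ties broken arbitrarily). Then the coverage of the resulting partition is at least $\frac{1}{2}\mathrm{OPT}$.
   Context: This is the SET K-COVER problem: given $S$, the collection $\{S_j\}_{j=1}^n$ and $k$, find a partition of the subsets into $k$ covers maximizing $\sum_{i=1}^k |\bigcup_{S_j\in c_i} S_j|$. *)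

theory Defs
  imports Complex_Main "HOL-Library.Disjoint_Sets"
begin

text \<open>
  The collection is an indexed family \<open>S 1, \<dots>, S n\<close>, so repeated subsets are assigned separately.
  A cover is represented by the set of indices assigned to it: \<open>j \<in> c i\<close> means that \<open>S j\<close> is put
  into the \<open>i\<close>-th cover. Covers are numbered \<open>1, \<dots>, k\<close> (values of \<open>c\<close> elsewhere are irrelevant),
  and a cover may be empty, as the greedy algorithm may leave covers unused.
\<close>

definition is_partition :: "nat \<Rightarrow> nat \<Rightarrow> (nat \<Rightarrow> nat set) \<Rightarrow> bool" where
  "is_partition n k c \<longleftrightarrow> disjoint_family_on c {1..k} \<and> (\<Union>i\<in>{1..k}. c i) = {1..n}"

definition covered :: "(nat \<Rightarrow> 'a set) \<Rightarrow> nat set \<Rightarrow> 'a set" where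
  "covered S J = (\<Union>j\<in>J. S j)"

definition coverage :: "(nat \<Rightarrow> 'a set) \<Rightarrow> nat \<Rightarrow> (nat \<Rightarrow> nat set) \<Rightarrow> nat" where
  "coverage S k c = (\<Sum>i=1..k. card (covered S (c i)))"

definition OPT :: "(nat \<Rightarrow> 'a set) \<Rightarrow> nat \<Rightarrow> nat \<Rightarrow> nat" where
  "OPT S n k = Max (coverage S k ` {c. is_partition n k c})"

text \<open>
  \<open>greedy S k m c\<close>: some run of the greedy algorithm is in state \<open>c\<close> after assigning
  \<open>S 1, \<dots>, S m\<close>. It is a relation since ties are broken arbitrarily.
\<close>

inductive greedy :: "(nat \<Rightarrow> 'a set) \<Rightarrow> nat \<Rightarrow> nat \<Rightarrow> (nat \<Rightarrow> nat set) \<Rightarrow> bool"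
  for S :: "nat \<Rightarrow> 'a set" and k :: nat where
  start: "greedy S k 0 (\<lambda>_. {})"
| assign: "greedy S k m c \<Longrightarrow>
    is_arg_max (\<lambda>i. card (S (Suc m) - covered S (c i))) (\<lambda>i. i \<in> {1..k}) i \<Longrightarrow>
    greedy S k (Suc m) (c(i := insert (Suc m) (c i)))"

text \<open>
  The maximum in \<^const>\<open>OPT\<close> is over a finite nonempty set of values, greedy runs exist, and every
  run ends in a partition.
\<close>

lemma finite_coverages:
  assumes "finite X" "\<And>j. j \<in> {1..n} \<Longrightarrow> S j \<subseteq> X"
  shows "finite (coverage S k ` {c. is_partition n k c})"
proof (rule finite_subset)
  show "coverage S k ` {c. is_partition n k c} \<subseteq> {..k * card X}"
  proof safe
    fix c assume c: "is_partition n k c"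
    have "card (covered S (c i)) \<le> card X" if i: "i \<in> {1..k}" for i
    proof (rule card_mono[OF assms(1)])
      have "c i \<subseteq> {1..n}"
        using c i unfolding is_partition_def by blast
      then show "covered S (c i) \<subseteq> X"
        unfolding covered_def using assms(2) by (meson UN_least subsetD)
    qed
    then show "coverage S k c \<le> k * card X"
      using sum_bounded_above[of "{1..k}" "\<lambda>i. card (covered S (c i))" "card X"]
      unfolding coverage_def by simp
  qed
qed simp

lemma greedy_exists:
  assumes "k \<ge> 1"
  shows "\<exists>c. greedy S k m c"
proof (induction m)
  case (Suc m)
  then obtain c where c: "greedy S k m c" by blast
  let ?f = "\<lambda>i. card (S (Suc m) - covered S (c i))"
  have "Max (?f ` {1..k}) \<in> ?f ` {1..k}"
    using assms by (intro Max_in) auto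
  then obtain i where i: "i \<in> {1..k}" "?f i = Max (?f ` {1..k})"
    by (metis (no_types, lifting) imageE)
  have "?f i' \<le> ?f i" if "i' \<in> {1..k}" for i'
    unfolding i(2) using that by (intro Max_ge) simp_all
  with i(1) have "is_arg_max ?f (\<lambda>i. i \<in> {1..k}) i"
    unfolding is_arg_max_linorder by blast
  then show ?case using greedy.assign[OF c] by blast
next
  case 0
  show ?case by (rule exI) (rule greedy.start)
qed

lemma greedy_is_partition:
  assumes "greedy S k n c"
  shows "is_partition n k c"
  using assms
proof induction
  case start
  then show ?case by (simp add: is_partition_def disjoint_family_on_def)
next
  case (assign m c i)
  let ?c = "c(i := insert (Suc m) (c i))"
  have i: "i \<in> {1..k}" using assign.hyps by (simp add: is_arg_max_def)
  have U: "(\<Union>i\<in>{1..k}. c i) = {1..m}" and D: "disjoint_family_on c {1..k}"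
    using assign.IH by (auto simp: is_partition_def)
  have U': "(\<Union>i\<in>{1..k}. ?c i) = insert (Suc m) (\<Union>i\<in>{1..k}. c i)"
    using i by (auto split: if_splits)
  have "Suc m \<notin> c j" if "j \<in> {1..k}" for j
  proof
    assume "Suc m \<in> c j"
    then have "Suc m \<in> {1..m}" using that U by blast
    then show False by simp
  qed
  then have D': "disjoint_family_on ?c {1..k}"
    using D by (auto simp: disjoint_family_on_def)
  have "insert (Suc m) {1..m} = {1..Suc m}" by auto
  then show ?case
    unfolding is_partition_def using U U' D' by (simp only: simp_thms)
qed

lemma coverages_nonempty:
  assumes "k \<ge> 1"
  shows "coverage S k ` {c. is_partition n k c} \<noteq> {}"
proof -
  obtain c where "greedy S k n c" using greedy_exists[OF assms] by blast
  then have "is_partition n k c" by (rule greedy_is_partition)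
  then show ?thesis by blast
qed

end

theory Submission
  imports Defs
begin

text \<open>
  Superimpose the part of a competing partition \<open>d\<close> that uses only the first \<open>m\<close> subsets on the greedy
  state \<open>c\<close>. When greedy assigns the next subset with gain \<open>g\<close>, the superimposed coverage grows
  by at most \<open>g\<close> in the cover chosen by greedy and, by maximality of \<open>g\<close>, by at most \<open>g\<close> in the
  cover chosen by \<open>d\<close>. So the superimposed coverage never exceeds twice the greedy coverage.
\<close>

lemma covered_insert: "covered S (insert j J) = S j \<union> covered S J"
  by (simp add: covered_def)

lemma covered_mono: "J \<subseteq> K \<Longrightarrow> covered S J \<subseteq> covered S K"
  by (auto simp: covered_def)

text \<open>Diminishing returns: what \<open>S j\<close> adds to the larger
  \<open>covered S J\<close> lies inside what it adds to the smaller \<open>covered S K\<close>.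
  This transfers a gain measured on a greedy cover to any cover extending it.\<close>

lemma card_covered_insert_le:
  assumes "finite (S j)" "K \<subseteq> J"
  shows "card (covered S (insert j J)) \<le> card (covered S J) + card (S j - covered S K)"
proof -
  have "covered S (insert j J) = covered S J \<union> (S j - covered S J)"
    by (auto simp: covered_insert)
  then have "card (covered S (insert j J)) \<le> card (covered S J) + card (S j - covered S J)"
    by (simp only: card_Un_le)
  also have "card (S j - covered S J) \<le> card (S j - covered S K)"
    using assms covered_mono[OF assms(2), of S] by (intro card_mono) auto
  finally show ?thesis by simp
qed

lemma card_covered_insert:
  assumes "finite (S j)" "finite (covered S J)"
  shows "card (covered S (insert j J)) = card (covered S J) + card (S j - covered S J)"
proof -
  have "covered S (insert j J) = covered S J \<union> (S j - covered S J)"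
    by (auto simp: covered_insert)
  then show ?thesis
    using assms by (simp only: card_Un_disjoint finite_Diff Diff_disjoint)
qed

lemma coverage_assign:
  assumes "i \<in> {1..k}" "finite (S j)" "finite (covered S (c i))"
  shows "coverage S k (c(i := insert j (c i))) = coverage S k c + card (S j - covered S (c i))"
proof -
  have "coverage S k (c(i := insert j (c i)))
      = (\<Sum>t=1..k. card (covered S (c t)) + (if t = i then card (S j - covered S (c i)) else 0))"
    unfolding coverage_def using assms
    by (intro sum.cong) (auto simp: card_covered_insert)
  also have "\<dots> = coverage S k c + card (S j - covered S (c i))"
    using assms(1) by (simp add: coverage_def sum.distrib)
  finally show ?thesis .
qed

text \<open>By disjointness \<open>x\<close> lies in at most one \<open>d t\<close>, so at most one
  summand equals \<open>g\<close>. Hence a competing partition is charged at most one gain per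
  assigned subset.\<close>

lemma sum_if_mem_disjoint_le:
  fixes g :: nat
  assumes "disjoint_family_on d I" "finite I"
  shows "(\<Sum>t\<in>I. if x \<in> d t then g else 0) \<le> g"
proof -
  have "card {t \<in> I. x \<in> d t} \<le> Suc 0"
    using assms by (subst card_le_Suc0_iff_eq) (auto simp: disjoint_family_on_def)
  then show ?thesis
    using assms(2) by (simp add: sum.If_cases Int_def)
qed

text \<open>Induction along the greedy run with \<open>d\<close> fixed. Cutting \<open>d\<close>
  down to \<open>{1..m}\<close> makes both sides zero at the start and lets each step bring in just
  the index \<open>Suc m\<close>. Of \<open>d\<close> only disjointness is assumed, as it need not
  be a partition of the prefix \<open>{1..m}\<close>.\<close>

lemma greedy_superimposed_coverage:
  assumes "greedy S k m c"
    and "disjoint_family_on d {1..k}"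
    and "\<And>j. j \<in> {1..m} \<Longrightarrow> finite (S j)"
  shows "coverage S k (\<lambda>i. d i \<inter> {1..m} \<union> c i) \<le> 2 * coverage S k c"
  using assms(1,3)
proof induction
  case start
  then show ?case by (simp add: coverage_def covered_def)
next
  case (assign m c i)
  define g where "g = card (S (Suc m) - covered S (c i))"
  define D where "D t = d t \<inter> {1..m} \<union> c t" for t
  have max: "card (S (Suc m) - covered S (c t)) \<le> g" if "t \<in> {1..k}" for t
    using assign.hyps(2) that unfolding is_arg_max_linorder g_def by blast
  from assign.hyps(2) have i: "i \<in> {1..k}" by (simp add: is_arg_max_def)
  have fin: "finite (S (Suc m))" using assign.prems by simp
  \<comment> \<open>The greedy cover uses only indices whose subsets are known to be finite, so the
    exact gain formula applies to it.\<close>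
  have "c i \<subseteq> {1..m}"
    using greedy_is_partition[OF assign.hyps(1)] i unfolding is_partition_def by blast
  then have "finite (covered S (c i))"
    unfolding covered_def using assign.prems
    by (intro finite_UN_I) (auto intro: finite_subset)
  then have gain: "coverage S k (c(i := insert (Suc m) (c i))) = coverage S k c + g"
    unfolding g_def using i fin by (rule coverage_assign[rotated 2])
  \<comment> \<open>Cover \<open>t\<close> is charged \<open>g\<close> once as the choice of greedy
    and once as the choice of \<open>d\<close>. If both choices coincide, the bound is generous: the
    cover grows by at most \<open>g\<close>.\<close>
  have step: "card (covered S (d t \<inter> {1..Suc m} \<union> (c(i := insert (Suc m) (c i))) t))
      \<le> card (covered S (D t)) + ((if t = i then g else 0) + (if Suc m \<in> d t then g else 0))"
    if t: "t \<in> {1..k}" for t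
  proof (cases "t = i \<or> Suc m \<in> d t")
    case True
    then have "d t \<inter> {1..Suc m} \<union> (c(i := insert (Suc m) (c i))) t = insert (Suc m) (D t)"
      by (auto simp: D_def le_Suc_eq)
    \<comment> \<open>Since \<open>c t \<subseteq> D t\<close>, the growth is at most the gain of
      \<open>S (Suc m)\<close> on \<open>c t\<close>. Maximality bounds this by \<open>g\<close>
      even where \<open>t \<noteq> i\<close>.\<close>
    moreover have "card (covered S (insert (Suc m) (D t))) \<le> card (covered S (D t)) + g"
      using card_covered_insert_le[of S "Suc m" "c t" "D t", OF fin] max[OF t]
      by (auto simp: D_def)
    ultimately show ?thesis using True by auto
  next
    case False
    then have "d t \<inter> {1..Suc m} \<union> (c(i := insert (Suc m) (c i))) t = D t"
      by (auto simp: D_def le_Suc_eq)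
    then show ?thesis by simp
  qed
  have "coverage S k (\<lambda>t. d t \<inter> {1..Suc m} \<union> (c(i := insert (Suc m) (c i))) t)
      \<le> (\<Sum>t=1..k. card (covered S (D t))
          + ((if t = i then g else 0) + (if Suc m \<in> d t then g else 0)))"
    unfolding coverage_def by (intro sum_mono step)
  also have "\<dots> = coverage S k D + (g + (\<Sum>t=1..k. if Suc m \<in> d t then g else 0))"
    using i by (simp add: coverage_def sum.distrib)
  also have "\<dots> \<le> coverage S k D + (g + g)"
    using sum_if_mem_disjoint_le[OF assms(2)] by simp
  also have "coverage S k D \<le> 2 * coverage S k c"
    unfolding D_def using assign.prems by (intro assign.IH) simp
  finally show ?case
    unfolding gain by simp
qed

lemma coverage_le_twice_greedy:
  assumes "greedy S k n c" "is_partition n k d" "\<And>j. j \<in> {1..n} \<Longrightarrow> finite (S j)"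
  shows "coverage S k d \<le> 2 * coverage S k c"
proof -
  \<comment> \<open>With all \<open>n\<close> subsets assigned, the cut to \<open>{1..n}\<close>
    loses nothing of \<open>d\<close>, and adding \<open>c i\<close> can only enlarge each
    cover.\<close>
  have "coverage S k d \<le> coverage S k (\<lambda>i. d i \<inter> {1..n} \<union> c i)"
    unfolding coverage_def
  proof (intro sum_mono card_mono covered_mono)
    fix i assume i: "i \<in> {1..k}"
    have sub: "d i \<subseteq> {1..n}" "c i \<subseteq> {1..n}"
      using assms(2) greedy_is_partition[OF assms(1)] i unfolding is_partition_def by blast+
    then show "d i \<subseteq> d i \<inter> {1..n} \<union> c i" by blast
    show "finite (covered S (d i \<inter> {1..n} \<union> c i))"
      unfolding covered_def using sub assms(3)
      by (intro finite_UN_I) (auto intro: finite_subset)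
  qed
  also have "\<dots> \<le> 2 * coverage S k c"
    using assms by (intro greedy_superimposed_coverage) (auto simp: is_partition_def)
  finally show ?thesis .
qed

theorem theorem2:
  fixes X :: "'a set" and S :: "nat \<Rightarrow> 'a set" and n k :: nat and c :: "nat \<Rightarrow> nat set"
  assumes "finite X"
    and "\<And>j. j \<in> {1..n} \<Longrightarrow> S j \<subseteq> X"
    and "k \<ge> 2"
    and "greedy S k n c"
  shows "real (coverage S k c) \<ge> 1 / 2 * real (OPT S n k)"
proof -
  have "finite (S j)" if "j \<in> {1..n}" for j
    using assms(1,2) that by (metis finite_subset)
  then have "coverage S k d \<le> 2 * coverage S k c" if "is_partition n k d" for d
    using coverage_le_twice_greedy assms(4) that by blast
  moreover have "finite (coverage S k ` {d. is_partition n k d})"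
    using assms(1,2) by (rule finite_coverages)
  moreover have "coverage S k ` {d. is_partition n k d} \<noteq> {}"
    using assms(3) by (intro coverages_nonempty) simp
  ultimately have "OPT S n k \<le> 2 * coverage S k c"
    unfolding OPT_def by (subst Max_le_iff) auto
  then show ?thesis by simp
qed

end
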